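(* Let $\alpha_1,\alpha_2,\alpha_3\in(0,1]$, $A\in\mathbb{R}^{3\times 3}$, and suppose that the characteristic function $Q(s)=\det(\operatorname{diag}(s^{\alpha_1},s^{\alpha_2},s^{\alpha_3})-A)$ has the form $$Q(s)=s^{\beta_4}-a s^{\beta_3}-b s^{\beta_2}-c s^{\beta_1}-d$$ with $0<\beta_1\le\beta_2\le\beta_3<\beta_4$, where $\beta_4=\alpha_1+\alpha_2+\alpha_3$, $a,b,c\in\mathbb{R}$ and $d=\det A$. Assume that $\beta_4<2$ and that (a) either $b=c=0$, $a>0$ and $d<-a\,\rho_3\,(a\,\tilde\rho_3)^{\beta_3/(\beta_4-\beta_3)}$, (b) or $a=c=0$, $b>0$ and $d<-b\,\rho_2\,(b\,\tilde\rho_2)^{\beta_2/(\beta_4-\beta_2)}$. Then all zeros of $Q$ lie in the open left half of $\mathbb{C}$.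
   Context: Complex powers are taken with the principal branch: $s^\beta=|s|^\beta e^{\mathrm{i}\beta\arg s}$ with $\arg s\in(-\pi,\pi]$ for $s\neq 0$, and $0^\beta=0$ for $\beta>0$. Notation, for $i=2,3$: $$\rho_i=\frac{\sin\frac{(\beta_4-\beta_i)\pi}{2}}{\sin\frac{\beta_4\pi}{2}},\qquad \tilde\rho_i=\frac{\sin\frac{\beta_i\pi}{2}}{\sin\frac{\beta_4\pi}{2}}.$$ *)

theory Defs
  imports "HOL-Analysis.Analysis"
begin

definition diag_matrix :: "'a::zero ^ 'n \<Rightarrow> 'a ^ 'n ^ 'n" where
  "diag_matrix v = (\<chi> i j. if i = j then v $ i else 0)"

text \<open>
  The library's complex \<open>powr\<close> is the principal branch, with \<open>Im (Ln s)\<close> in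
  \<open>(-\<pi>, \<pi>]\<close> for \<open>s \<noteq> 0\<close>, and \<open>0 powr z = 0\<close> for every \<open>z\<close>.
\<close>

definition char_fun :: "real ^ 'n \<Rightarrow> real ^ 'n ^ 'n \<Rightarrow> complex \<Rightarrow> complex" where
  "char_fun \<alpha> A s =
     det (diag_matrix (\<chi> i. s powr complex_of_real (\<alpha> $ i)) - map_matrix complex_of_real A)"

definition rho :: "real \<Rightarrow> real \<Rightarrow> real" where
  "rho \<beta>4 \<beta> = sin ((\<beta>4 - \<beta>) * pi / 2) / sin (\<beta>4 * pi / 2)"

definition rho_tilde :: "real \<Rightarrow> real \<Rightarrow> real" where
  "rho_tilde \<beta>4 \<beta> = sin (\<beta> * pi / 2) / sin (\<beta>4 * pi / 2)"

end

theory Submission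
  imports Defs
begin

text \<open>
  Let \<open>s = r e\<^sup>i\<^sup>\<theta>\<close> with \<open>0 < \<theta> \<le> \<pi>/2\<close> be a zero of \<open>s\<^sup>p - a s\<^sup>q + D\<close>. The imaginary part gives
  \<open>r\<^sup>p\<^sup>-\<^sup>q = a sin (q \<theta>) / sin (p \<theta>)\<close>, and then the real part gives
  \<open>D = a r\<^sup>q sin ((p - q) \<theta>) / sin (p \<theta>)\<close>. Both quotients of sines are nondecreasing in \<open>\<theta>\<close>, so
  \<open>D\<close> is at most its value at \<open>\<theta> = \<pi>/2\<close>, which is the bound in the hypothesis. For \<open>\<theta> = 0\<close>,
  \<open>D = a r\<^sup>q - r\<^sup>p\<close> is bounded by Young's inequality, and the result is the limit of the
  former expression as \<open>\<theta> \<rightarrow> 0\<close>.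
\<close>

text \<open>Sine is concave on \<open>[0, pi]\<close>, so its graph lies above the chord from 0 to
  \<open>x\<close>.\<close>

lemma sin_scale_ge:
  fixes t x :: real
  assumes "0 \<le> t" "t \<le> 1" "0 \<le> x" "x \<le> pi"
  shows "t * sin x \<le> sin (t * x)"
proof -
  have "convex_on {0..pi} (\<lambda>x. - sin x :: real)"
  proof (rule f''_ge0_imp_convex)
    show "((\<lambda>x. - sin x) has_real_derivative - cos x) (at x)" for x :: real
      by (auto intro!: derivative_eq_intros)
    show "((\<lambda>x. - cos x) has_real_derivative sin x) (at x)" for x :: real
      by (auto intro!: derivative_eq_intros)
  qed (auto intro: sin_ge_zero)
  from convex_onD[OF this, of t 0 x] show ?thesis
    using assms by simp
qed

text \<open>For \<open>u\<close> up to \<open>pi\<close> this is the monotonicity of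
  \<open>sin x / x\<close>, cleared of denominators; beyond \<open>pi\<close> the two sines have
  opposite signs. The range up to \<open>2 * pi\<close> lets \<open>u\<close> be a sum of two angles
  below \<open>pi\<close>.\<close>

lemma mult_sin_le_mult_sin:
  fixes u v :: real
  assumes "0 \<le> v" "v \<le> u" "v \<le> pi" "u \<le> 2 * pi"
  shows "v * sin u \<le> u * sin v"
proof (cases "u \<le> pi")
  case True
  show ?thesis
  proof (cases "u = 0")
    case False
    then have "v / u * sin u \<le> sin (v / u * u)"
      using assms True by (intro sin_scale_ge) auto
    then show ?thesis
      using False assms by (simp add: field_simps)
  qed (use assms in auto)
next
  case False
  have "sin u \<le> 0"
    using False assms sin_ge_zero[of "u - pi"] by (simp add: sin_diff)
  moreover have "0 \<le> sin v"
    using assms by (intro sin_ge_zero) auto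
  ultimately show ?thesis
    using assms by (meson mult_nonneg_nonneg mult_nonneg_nonpos order_trans)
qed

lemma sin_quotient_mono:
  fixes k p x y :: real
  assumes "0 \<le> k" "k \<le> p" "0 < p" "0 < x" "x \<le> y" "p * y < pi"
  shows "sin (k * x) / sin (p * x) \<le> sin (k * y) / sin (p * y)"
proof (rule DERIV_nonneg_imp_nondecreasing[OF \<open>x \<le> y\<close>])
  fix z assume z: "x \<le> z" "z \<le> y"
  have "p * z \<le> p * y"
    using assms z by (intro mult_left_mono) auto
  also have "\<dots> < pi"
    by fact
  finally have pz: "0 < p * z" "p * z < pi"
    using assms z by auto
  then have sp: "0 < sin (p * z)"
    by (rule sin_gt_zero)
  have kz: "0 \<le> k * z" "k * z \<le> p * z"
    using assms z by (auto intro: mult_right_mono)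
  \<comment> \<open>By the product formulas, \<open>z\<close> times the numerator of the derivative is
    \<open>(u sin v - v sin u) / 2\<close> with \<open>u = (p + k) z\<close> and \<open>v = (p - k) z\<close>.\<close>
  have "(p * z - k * z) * sin (p * z + k * z) \<le> (p * z + k * z) * sin (p * z - k * z)"
    using pz kz by (intro mult_sin_le_mult_sin) auto
  then have "0 \<le> z * (k * cos (k * z) * sin (p * z) - p * sin (k * z) * cos (p * z))"
    by (simp add: sin_add sin_diff algebra_simps)
  then have num: "0 \<le> k * cos (k * z) * sin (p * z) - p * sin (k * z) * cos (p * z)"
    using assms z by (simp add: zero_le_mult_iff)
  have "((\<lambda>z. sin (k * z) / sin (p * z)) has_real_derivative
      (k * cos (k * z) * sin (p * z) - p * sin (k * z) * cos (p * z)) / (sin (p * z))\<^sup>2) (at z)"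
    using sp by (auto intro!: derivative_eq_intros simp: power2_eq_square field_simps)
  moreover have "0 \<le> (k * cos (k * z) * sin (p * z) - p * sin (k * z) * cos (p * z))
      / (sin (p * z))\<^sup>2"
    using num by simp
  ultimately show "\<exists>D. ((\<lambda>z. sin (k * z) / sin (p * z)) has_real_derivative D) (at z) \<and> 0 \<le> D"
    by blast
qed

text \<open>\<open>k / p\<close> is the limit of the quotient as \<open>y\<close> tends to 0.
  Concavity of sine gives the bound directly, without passing to the limit.\<close>

lemma ratio_le_sin_quotient:
  fixes k p y :: real
  assumes "0 \<le> k" "k \<le> p" "0 < p" "0 < y" "p * y < pi"
  shows "k / p \<le> sin (k * y) / sin (p * y)"
proof -
  have "0 < sin (p * y)"
    using assms by (intro sin_gt_zero) auto
  moreover have "k / p * sin (p * y) \<le> sin (k / p * (p * y))"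
    using assms by (intro sin_scale_ge) auto
  ultimately show ?thesis
    using assms by (simp add: field_simps)
qed

text \<open>The right side is the maximum of the left over \<open>r > 0\<close>, attained at the
  critical point, where \<open>r powr (p - q) = a * (q / p)\<close>. Measuring \<open>r\<close> in
  units of this point \<open>R\<close> leaves Young's inequality for \<open>t powr p\<close> and
  1.\<close>

lemma powr_diff_le_max:
  fixes a p q r :: real
  assumes "0 < q" "q < p" "0 < a" "0 < r"
  shows "a * r powr q - r powr p \<le> a * ((p - q) / p) * (a * (q / p)) powr (q / (p - q))"
proof -
  define m where "m = a * (q / p)"
  have m: "0 < m"
    using assms by (simp add: m_def)
  define R where "R = m powr (1 / (p - q))"
  have R: "0 < R" "R powr (p - q) = m" "R powr q = m powr (q / (p - q))"
    using m assms by (simp_all add: R_def powr_powr)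
  define t where "t = r / R"
  have t: "0 < t" "r = R * t"
    using R assms by (simp_all add: t_def)
  have "(t powr p) powr (q / p) * 1 powr ((p - q) / p) \<le> q / p * t powr p + (p - q) / p * 1"
    using assms t by (intro Youngs_inequality_0) (auto simp: field_simps)
  then have young: "t powr q - q / p * t powr p \<le> (p - q) / p"
    using assms by (simp add: powr_powr)
  have "R powr p = R powr q * m"
    using R by (metis add.commute diff_add_cancel powr_add)
  then have "a * r powr q - r powr p = a * R powr q * (t powr q - q / p * t powr p)"
    using R t by (simp add: powr_mult m_def algebra_simps)
  also have "\<dots> \<le> a * R powr q * ((p - q) / p)"
    using young R assms by (intro mult_left_mono) auto
  finally show ?thesis
    by (simp add: R m_def mult_ac)
qed

lemma polar_zero_bound:
  fixes a p q r \<theta> D :: real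
  assumes pq: "0 < q" "q < p" "p < 2" and "0 < a" "0 < r"
    and \<theta>: "0 \<le> \<theta>" "\<theta> \<le> pi / 2"
    and re: "r powr p * cos (p * \<theta>) - a * (r powr q * cos (q * \<theta>)) + D = 0"
    and im: "r powr p * sin (p * \<theta>) = a * (r powr q * sin (q * \<theta>))"
  shows "D \<le> a * rho p q * (a * rho_tilde p q) powr (q / (p - q))"
proof -
  \<comment> \<open>Zero and positive angles both lead to a bound of this shape, which increases
    with \<open>u\<close> and \<open>v\<close>.\<close>
  have mono: "a * u * (a * v) powr (q / (p - q)) \<le> a * rho p q * (a * rho_tilde p q) powr (q / (p - q))"
    if "0 \<le> u" "0 \<le> v" "u \<le> sin ((p - q) * (pi / 2)) / sin (p * (pi / 2))"
       "v \<le> sin (q * (pi / 2)) / sin (p * (pi / 2))" for u v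
  proof -
    have "u \<le> rho p q" "v \<le> rho_tilde p q"
      using that by (simp_all add: rho_def rho_tilde_def)
    then show ?thesis
      using that pq \<open>0 < a\<close> by (intro mult_mono powr_mono2) auto
  qed
  have p2: "p * (pi / 2) < pi"
    using pq by simp
  show ?thesis
  proof (cases "\<theta> = 0")
    case True
    \<comment> \<open>At angle 0 the imaginary part says nothing about \<open>r\<close>, so the
      bound must hold for every \<open>r\<close>.\<close>
    then have "D = a * r powr q - r powr p"
      using re by simp
    also have "\<dots> \<le> a * ((p - q) / p) * (a * (q / p)) powr (q / (p - q))"
      using assms by (intro powr_diff_le_max) auto
    also have "\<dots> \<le> a * rho p q * (a * rho_tilde p q) powr (q / (p - q))"
      using pq p2 by (intro mono ratio_le_sin_quotient) auto
    finally show ?thesis .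
  next
    case False
    then have \<theta>0: "0 < \<theta>"
      using \<theta> by simp
    have p\<theta>: "p * \<theta> < pi"
      using pq by (intro order.strict_trans1[OF mult_left_mono[OF \<theta>(2)] p2]) simp
    have sp: "0 < sin (p * \<theta>)"
      using \<theta>0 pq p\<theta> by (intro sin_gt_zero) auto
    have sin_nonneg: "0 \<le> sin (k * \<theta>)" if "0 \<le> k" "k \<le> p" for k
    proof (rule sin_ge_zero)
      have "k * \<theta> \<le> p * \<theta>"
        using that \<theta> by (intro mult_right_mono)
      then show "k * \<theta> \<le> pi"
        using p\<theta> by linarith
    qed (use that \<theta> in simp)
    define v where "v = sin (q * \<theta>) / sin (p * \<theta>)"
    define u where "u = sin ((p - q) * \<theta>) / sin (p * \<theta>)"
    have "r powr (p - q) = a * v"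
      using im sp \<open>0 < r\<close> by (simp add: v_def powr_diff field_simps)
    then have "(a * v) powr (q / (p - q)) = r powr ((p - q) * (q / (p - q)))"
      by (metis powr_powr)
    then have rq: "r powr q = (a * v) powr (q / (p - q))"
      using pq by simp
    have "D = a * (r powr q * cos (q * \<theta>)) - r powr p * cos (p * \<theta>)"
      using re by linarith
    \<comment> \<open>The factor \<open>sin (p * \<theta>)\<close> lets \<open>im\<close> trade
      \<open>r powr p\<close> for \<open>r powr q\<close>; the subtraction formula for sine then
      applies.\<close>
    then have "D * sin (p * \<theta>)
        = a * r powr q * (cos (q * \<theta>) * sin (p * \<theta>)) - (r powr p * sin (p * \<theta>)) * cos (p * \<theta>)"
      by (simp only:) (simp add: algebra_simps)
    also have "\<dots> = a * r powr q * sin ((p - q) * \<theta>)"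
      by (simp only: im) (simp add: sin_diff algebra_simps)
    finally have "D = a * u * r powr q"
      using sp by (simp add: u_def field_simps)
    also have "\<dots> = a * u * (a * v) powr (q / (p - q))"
      by (simp only: rq)
    also have "\<dots> \<le> a * rho p q * (a * rho_tilde p q) powr (q / (p - q))"
      unfolding u_def v_def using pq p2 \<theta> \<theta>0 sp
      by (intro mono sin_quotient_mono divide_nonneg_pos sin_nonneg) auto
    finally show ?thesis .
  qed
qed

lemma powr_of_real_polar:
  fixes s :: complex and x :: real
  assumes "s \<noteq> 0"
  shows "s powr of_real x = of_real (cmod s powr x) * cis (x * Arg s)"
  using assms by (simp add: powr_def Ln_Arg exp_add distrib_left exp_of_real cis_conv_exp mult_ac flip: of_real_mult)

lemma trinomial_zeros_Re_neg:
  fixes a p q d :: real and s :: complex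
  assumes pq: "0 < q" "q < p" "p < 2" and "0 < a"
    and d: "d < - a * rho p q * (a * rho_tilde p q) powr (q / (p - q))"
    and zero: "s powr of_real p - of_real a * s powr of_real q - of_real d = 0"
  shows "Re s < 0"
proof (rule ccontr)
  assume "\<not> Re s < 0"
  then have Re_s: "0 \<le> Re s"
    by simp
  have "0 \<le> sin ((p - q) * pi / 2)" "0 \<le> sin (p * pi / 2)"
    using pq by (intro sin_ge_zero; simp)+
  then have "0 \<le> a * rho p q * (a * rho_tilde p q) powr (q / (p - q))"
    using \<open>0 < a\<close> by (simp add: rho_def)
  then have "d < 0"
    using d by simp
  \<comment> \<open>At the origin both powers vanish, so the equation would force
    \<open>d = 0\<close>.\<close>
  then have s: "s \<noteq> 0"
    using zero by auto
  have "- d \<le> a * rho p q * (a * rho_tilde p q) powr (q / (p - q))"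
  proof (rule polar_zero_bound[OF pq \<open>0 < a\<close>])
    show "0 < cmod s" "0 \<le> \<bar>Arg s\<bar>"
      using s by auto
    show "\<bar>Arg s\<bar> \<le> pi / 2"
      using Re_s s by (simp add: Arg_eq_Im_Ln Re_Ln_pos_le del: divide_le_eq_numeral1 le_divide_eq_numeral1)
    have eq: "of_real (cmod s powr p) * cis (p * Arg s)
        - of_real a * (of_real (cmod s powr q) * cis (q * Arg s)) - of_real d = 0"
      using zero by (simp add: powr_of_real_polar s)
    \<comment> \<open>The real part is even and the imaginary part odd in the argument, so
      \<open>Arg s\<close> may be replaced by its absolute value.\<close>
    show "cmod s powr p * cos (p * \<bar>Arg s\<bar>) - a * (cmod s powr q * cos (q * \<bar>Arg s\<bar>)) + - d = 0"
      using arg_cong[OF eq, of Re] by (cases "0 \<le> Arg s") simp_all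
    show "cmod s powr p * sin (p * \<bar>Arg s\<bar>) = a * (cmod s powr q * sin (q * \<bar>Arg s\<bar>))"
      using arg_cong[OF eq, of Im] by (cases "0 \<le> Arg s") simp_all
  qed
  then show False
    using d by simp
qed

theorem lemma12:
  fixes \<alpha> :: "real ^ 3" and A :: "real ^ 3 ^ 3"
    and \<beta>1 \<beta>2 \<beta>3 \<beta>4 a b c d :: real
  assumes "\<And>i. 0 < \<alpha> $ i" and "\<And>i. \<alpha> $ i \<le> 1"
    and "0 < \<beta>1" and "\<beta>1 \<le> \<beta>2" and "\<beta>2 \<le> \<beta>3" and "\<beta>3 < \<beta>4"
    and "\<beta>4 = \<alpha> $ 1 + \<alpha> $ 2 + \<alpha> $ 3"
    and "d = det A"
    and "\<And>s :: complex. char_fun \<alpha> A s =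
           s powr complex_of_real \<beta>4 - complex_of_real a * s powr complex_of_real \<beta>3
           - complex_of_real b * s powr complex_of_real \<beta>2
           - complex_of_real c * s powr complex_of_real \<beta>1 - complex_of_real d"
    and "\<beta>4 < 2"
    and "(b = 0 \<and> c = 0 \<and> a > 0 \<and>
            d < - a * rho \<beta>4 \<beta>3 * (a * rho_tilde \<beta>4 \<beta>3) powr (\<beta>3 / (\<beta>4 - \<beta>3)))
       \<or> (a = 0 \<and> c = 0 \<and> b > 0 \<and>
            d < - b * rho \<beta>4 \<beta>2 * (b * rho_tilde \<beta>4 \<beta>2) powr (\<beta>2 / (\<beta>4 - \<beta>2)))"
  shows "\<forall>s :: complex. char_fun \<alpha> A s = 0 \<longrightarrow> Re s < 0"
  \<comment> \<open>Each alternative leaves a trinomial, with middle exponent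
    \<open>\<beta>3\<close> or \<open>\<beta>2\<close>.\<close>
  using assms(3-6,9-11) trinomial_zeros_Re_neg[of \<beta>3 \<beta>4 a d] trinomial_zeros_Re_neg[of \<beta>2 \<beta>4 b d]
  by auto

end
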